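(* Let $q\ge1$ and $0\le r\le q$ be integers and $\beta$ a constant. Let $G$ be a finite graph with an interaction energy $J_e$ on each edge $e$ and, at each vertex $v_i$, a magnetic field vector $\boldsymbol{M}_i=(M_{i,1},\dots,M_{i,r},0,\dots,0)\in\mathbb{C}^q$. Let $Z(G)=\sum_\sigma\mathrm{e}^{-\beta h(\sigma)}$ with \[h(\sigma)=-\sum_{e=\{v_i,v_j\}\in E(G)}J_e\,\delta(\sigma_i,\sigma_j)-\sum_{v_i\in V(G)}\sum_{\alpha=1}^q M_{i,\alpha}\,\delta(\alpha,\sigma_i).\] Then \[Z(G)=\boldsymbol{V}\Big(G,\omega;\{X_{\boldsymbol{M}}\}_{\boldsymbol{M}\in\mathbb{C}^q},\{\mathrm{e}^{\beta J_e}-1\}_{e\in E(G)}\Big),\] where the vertex weights are $\omega(v_i)=\boldsymbol{M}_i$ and, for $\boldsymbol{M}=(M_1,\dots,M_q)\in\mathbb{C}^q$, $X_{\boldsymbol{M}}=q-r+\sum_{\alpha=1}^r\mathrm{e}^{\beta M_\alpha}$.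
   Context: Graphs are finite, loops and multiple edges allowed. A state is a map $\sigma:V(G)\to\{1,\dots,q\}$, $\sigma_i=\sigma(v_i)$; $Z$ sums over all states; $\delta$ is the Kronecker delta. The $\boldsymbol{V}$-polynomial here has vertex weights in the additive semigroup $S=\mathbb{C}^q$, variables $\{x_k\}_{k\in S}$ and edge weights $\gamma_e$, defined recursively by: for a non-loop edge $e$, $\boldsymbol{V}(G)=\boldsymbol{V}(G-e)+\gamma_e\boldsymbol{V}(G/e)$; for a loop $e$, $\boldsymbol{V}(G)=(\gamma_e+1)\boldsymbol{V}(G-e)$; for $m$ isolated vertices of weights $\omega_1,\dots,\omega_m$, $\boldsymbol{V}=\prod x_{\omega_i}$. Here $G-e$ deletes $e$, weights unchanged; $G/e$ contracts a non-loop edge $e=\{v_a,v_b\}$, the merged vertex receiving weight $\omega(v_a)+\omega(v_b)$. The equation means $x_{\boldsymbol{M}}$ is replaced by $X_{\boldsymbol{M}}$ and $\gamma_e$ by $\mathrm{e}^{\beta J_e}-1$. *)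

theory Defs
  imports
    Complex_Main
    "HOL-Library.FuncSet"
    "HOL-Library.Function_Algebras"
    "HOL-Library.Poly_Mapping"
    "HOL-Library.Uprod"
begin

section \<open>Graphs with loops and multiple edges\<close>

text \<open>The edges are names; the endpoints of an edge form an unordered pair, and \<open>Upair a a\<close>
  is a loop at \<open>a\<close>. Only the values of \<open>ends\<close> on \<open>edges\<close> are meaningful.\<close>

record ('v, 'e) multigraph =
  verts :: "'v set"
  edges :: "'e set"
  ends :: "'e \<Rightarrow> 'v uprod"

definition finite_multigraph :: "('v, 'e) multigraph \<Rightarrow> bool" where
  "finite_multigraph G \<longleftrightarrow>
     finite (verts G) \<and> finite (edges G) \<and> (\<forall>e\<in>edges G. set_uprod (ends G e) \<subseteq> verts G)"

definition delete_edge :: "('v, 'e) multigraph \<Rightarrow> 'e \<Rightarrow> ('v, 'e) multigraph" where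
  "delete_edge G e = G\<lparr>edges := edges G - {e}\<rparr>"

text \<open>Contraction of an edge \<open>e\<close> with distinct endpoints \<open>a\<close> and \<open>b\<close>: the merged vertex is
  called \<open>a\<close>. Edges parallel to \<open>e\<close> become loops at \<open>a\<close>.\<close>

definition contract_edge :: "('v, 'e) multigraph \<Rightarrow> 'e \<Rightarrow> 'v \<Rightarrow> 'v \<Rightarrow> ('v, 'e) multigraph" where
  "contract_edge G e a b =
     G\<lparr>verts := verts G - {b},
       edges := edges G - {e},
       ends := (\<lambda>f. map_uprod (\<lambda>v. if v = b then a else v) (ends G f))\<rparr>"


section \<open>Polynomials in the indeterminates $x_k$ and $\gamma_e$\<close>

datatype ('w, 'e) indet = X 'w | Gam 'e

text \<open>Integer polynomials: finitely supported maps from monomials (finitely supported exponent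
  functions) to coefficients, with convolution as multiplication.\<close>

type_synonym 'i int_mpoly = "('i \<Rightarrow>\<^sub>0 nat) \<Rightarrow>\<^sub>0 int"

definition indet_poly :: "'i \<Rightarrow> 'i int_mpoly" where
  "indet_poly i = Poly_Mapping.single (Poly_Mapping.single i 1) 1"

definition mpoly_subst :: "('i \<Rightarrow> 'a::comm_ring_1) \<Rightarrow> 'i int_mpoly \<Rightarrow> 'a" where
  "mpoly_subst s p =
     (\<Sum>m\<in>Poly_Mapping.keys p.
        of_int (Poly_Mapping.lookup p m) *
        (\<Prod>i\<in>Poly_Mapping.keys m. s i ^ Poly_Mapping.lookup m i))"


section \<open>The V-polynomial\<close>

text \<open>\<open>is_V_polynomial G \<omega> p\<close> states that \<open>p\<close> is obtained from the vertex-weighted graph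
  \<open>(G, \<omega>)\<close> by the deletion-contraction recursion, with the edges taken in any order and
  with either name for a merged vertex. \<open>V_polynomial\<close> is the unique such \<open>p\<close>.\<close>

inductive is_V_polynomial ::
  "('v, 'e) multigraph \<Rightarrow> ('v \<Rightarrow> 'w::ab_semigroup_add) \<Rightarrow> ('w, 'e) indet int_mpoly \<Rightarrow> bool"
where
  nonloop:
    "\<lbrakk>e \<in> edges G; ends G e = Upair a b; a \<noteq> b;
      is_V_polynomial (delete_edge G e) \<omega> p;
      is_V_polynomial (contract_edge G e a b) (\<omega>(a := \<omega> a + \<omega> b)) p'\<rbrakk>
     \<Longrightarrow> is_V_polynomial G \<omega> (p + indet_poly (Gam e) * p')"
| loop:
    "\<lbrakk>e \<in> edges G; ends G e = Upair a a;
      is_V_polynomial (delete_edge G e) \<omega> p\<rbrakk>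
     \<Longrightarrow> is_V_polynomial G \<omega> ((indet_poly (Gam e) + 1) * p)"
| isolated:
    "edges G = {} \<Longrightarrow> is_V_polynomial G \<omega> (\<Prod>v\<in>verts G. indet_poly (X (\<omega> v)))"

definition V_polynomial ::
  "('v, 'e) multigraph \<Rightarrow> ('v \<Rightarrow> 'w::ab_semigroup_add) \<Rightarrow> ('w, 'e) indet int_mpoly" where
  "V_polynomial G \<omega> = (THE p. is_V_polynomial G \<omega> p)"


section \<open>The Potts model in a magnetic field\<close>

text \<open>$\mathbb{C}^q$, with pointwise addition and with coordinates indexed by $1,\dots,q$.\<close>

definition complex_space :: "nat \<Rightarrow> (nat \<Rightarrow> complex) set" where
  "complex_space q = {u. \<forall>\<alpha>. \<alpha> \<notin> {1..q} \<longrightarrow> u \<alpha> = 0}"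

definition states :: "nat \<Rightarrow> ('v, 'e) multigraph \<Rightarrow> ('v \<Rightarrow> nat) set" where
  "states q G = verts G \<rightarrow>\<^sub>E {1..q}"

definition hamiltonian ::
  "nat \<Rightarrow> ('v, 'e) multigraph \<Rightarrow> ('e \<Rightarrow> complex) \<Rightarrow> ('v \<Rightarrow> nat \<Rightarrow> complex) \<Rightarrow> ('v \<Rightarrow> nat) \<Rightarrow> complex"
where
  "hamiltonian q G J M \<sigma> =
     - (\<Sum>e\<in>edges G. J e * of_bool (\<exists>i j. ends G e = Upair i j \<and> \<sigma> i = \<sigma> j))
     - (\<Sum>v\<in>verts G. \<Sum>\<alpha>=1..q. M v \<alpha> * of_bool (\<alpha> = \<sigma> v))"

definition partition_function ::
  "nat \<Rightarrow> complex \<Rightarrow> ('v, 'e) multigraph \<Rightarrow> ('e \<Rightarrow> complex) \<Rightarrow> ('v \<Rightarrow> nat \<Rightarrow> complex) \<Rightarrow> complex"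
where
  "partition_function q \<beta> G J M = (\<Sum>\<sigma>\<in>states q G. exp (- \<beta> * hamiltonian q G J M \<sigma>))"

text \<open>The substitution of $X_{\boldsymbol M}$ for $x_{\boldsymbol M}$ and of
  $\mathrm{e}^{\beta J_e} - 1$ for $\gamma_e$.\<close>

fun potts_subst ::
  "nat \<Rightarrow> nat \<Rightarrow> complex \<Rightarrow> ('e \<Rightarrow> complex) \<Rightarrow> (nat \<Rightarrow> complex, 'e) indet \<Rightarrow> complex"
where
  "potts_subst q r \<beta> J (X m) = of_nat q - of_nat r + (\<Sum>\<alpha>=1..r. exp (\<beta> * m \<alpha>))"
| "potts_subst q r \<beta> J (Gam e) = exp (\<beta> * J e) - 1"

end

theory Submission
  imports Defs
begin

text \<open>The recursion for the V-polynomial is well defined because every outcome equals the spanning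
  subgraph expansion \<open>\<Sum>A\<subseteq>E. (\<Prod>e\<in>A. \<gamma>\<^sub>e) * (\<Prod>C. x\<^bsub>\<omega>(C)\<^esub>)\<close>, with \<open>C\<close>
  ranging over the components of \<open>(V, A)\<close> and \<open>\<omega>(C)\<close> denoting the total weight of \<open>C\<close>. The partition
  function satisfies the same recursion: since \<open>exp (\<beta> J\<^sub>e \<delta>) = 1 + (exp (\<beta> J\<^sub>e) - 1) \<delta>\<close> for \<open>\<delta> \<in> {0, 1}\<close>, the sum over
  states splits into the sum for \<open>G - e\<close> and a sum over states agreeing at the ends of \<open>e\<close>,
  which are the states of \<open>G/e\<close>.\<close>

section \<open>Substitution into polynomials\<close>

definition monom_subst :: "('i \<Rightarrow> 'a::comm_ring_1) \<Rightarrow> ('i \<Rightarrow>\<^sub>0 nat) \<Rightarrow> 'a" where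
  "monom_subst s m = (\<Prod>i\<in>Poly_Mapping.keys m. s i ^ Poly_Mapping.lookup m i)"

text \<open>Indices outside the support have exponent 0 and contribute the factor 1, so monomials
  with different supports can share one index set.\<close>

lemma monom_subst_superset:
  assumes "finite K" "Poly_Mapping.keys m \<subseteq> K"
  shows "monom_subst s m = (\<Prod>i\<in>K. s i ^ Poly_Mapping.lookup m i)"
  unfolding monom_subst_def
  by (rule prod.mono_neutral_left) (use assms in \<open>auto simp: in_keys_iff\<close>)

lemma monom_subst_add: "monom_subst s (m + n) = monom_subst s m * monom_subst s n"
proof -
  let ?K = "Poly_Mapping.keys m \<union> Poly_Mapping.keys n"
  have "monom_subst s k = (\<Prod>i\<in>?K. s i ^ Poly_Mapping.lookup k i)"
    if "k \<in> {m, n, m + n}" for k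
    using that Poly_Mapping.keys_add[of m n] by (intro monom_subst_superset) auto
  then show ?thesis
    by (simp add: lookup_add power_add prod.distrib)
qed

lemma mpoly_subst_superset:
  assumes "finite K" "Poly_Mapping.keys p \<subseteq> K"
  shows "mpoly_subst s p = (\<Sum>m\<in>K. of_int (Poly_Mapping.lookup p m) * monom_subst s m)"
  unfolding mpoly_subst_def monom_subst_def
  by (rule sum.mono_neutral_left) (use assms in \<open>auto simp: in_keys_iff\<close>)

lemma mpoly_subst_add: "mpoly_subst s (p + p') = mpoly_subst s p + mpoly_subst s p'"
proof -
  let ?K = "Poly_Mapping.keys p \<union> Poly_Mapping.keys p'"
  have "mpoly_subst s k = (\<Sum>m\<in>?K. of_int (Poly_Mapping.lookup k m) * monom_subst s m)"
    if "k \<in> {p, p', p + p'}" for k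
    using that Poly_Mapping.keys_add[of p p'] by (intro mpoly_subst_superset) auto
  then show ?thesis
    by (simp add: lookup_add sum.distrib distrib_right)
qed

lemma mpoly_subst_zero [simp]: "mpoly_subst s 0 = 0"
  by (simp add: mpoly_subst_def)

lemma mpoly_subst_single: "mpoly_subst s (Poly_Mapping.single m c) = of_int c * monom_subst s m"
  by (subst mpoly_subst_superset[of "{m}"]) auto

lemma mpoly_subst_one [simp]: "mpoly_subst s 1 = 1"
  using mpoly_subst_single[of s 0 1] by (simp add: monom_subst_def)

lemma mpoly_subst_indet_poly [simp]: "mpoly_subst s (indet_poly i) = s i"
  by (simp add: indet_poly_def mpoly_subst_single monom_subst_def)

text \<open>Turns the step of \<open>update_induct\<close> into an addition, to which additivity of
  the substitution applies.\<close>

lemma update_eq_add_single: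
  assumes "a \<notin> Poly_Mapping.keys f"
  shows "Poly_Mapping.update a b f = f + Poly_Mapping.single a b"
  by (rule poly_mapping_eqI)
    (use assms in \<open>auto simp: lookup_update lookup_add lookup_single in_keys_iff\<close>)

text \<open>By distributivity and additivity, inductions on both factors reduce the claim to two
  one-term polynomials, whose exponents add under multiplication.\<close>

lemma mpoly_subst_mult: "mpoly_subst s (p * p') = mpoly_subst s p * mpoly_subst s p'"
proof (induction p rule: update_induct)
  case const
  then show ?case by simp
next
  case (update p m c)
  have "mpoly_subst s (Poly_Mapping.single m c * p') =
      mpoly_subst s (Poly_Mapping.single m c) * mpoly_subst s p'"
  proof (induction p' rule: update_induct)
    case const
    then show ?case by simp
  next
    case (update p' n d)
    then show ?case
      by (simp add: update_eq_add_single distrib_left mpoly_subst_add mult_single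
          mpoly_subst_single monom_subst_add mult_ac)
  qed
  with update show ?case
    by (simp add: update_eq_add_single distrib_right mpoly_subst_add)
qed

lemma mpoly_subst_prod: "mpoly_subst s (\<Prod>i\<in>I. f i) = (\<Prod>i\<in>I. mpoly_subst s (f i))"
  by (induction I rule: infinite_finite_induct) (simp_all add: mpoly_subst_mult)


section \<open>Deletion and contraction\<close>

lemma delete_edge_simps [simp]:
  "verts (delete_edge G e) = verts G"
  "edges (delete_edge G e) = edges G - {e}"
  "ends (delete_edge G e) = ends G"
  by (simp_all add: delete_edge_def)

lemma contract_edge_simps [simp]:
  "verts (contract_edge G e a b) = verts G - {b}"
  "edges (contract_edge G e a b) = edges G - {e}"
  "ends (contract_edge G e a b) f = map_uprod (\<lambda>v. if v = b then a else v) (ends G f)"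
  by (simp_all add: contract_edge_def)

lemma finite_multigraph_delete_edge:
  "finite_multigraph G \<Longrightarrow> finite_multigraph (delete_edge G e)"
  by (simp add: finite_multigraph_def)

lemma finite_multigraph_ends:
  assumes "finite_multigraph G" "e \<in> edges G" "ends G e = Upair a b"
  shows "a \<in> verts G" "b \<in> verts G"
  using assms by (auto simp: finite_multigraph_def)

text \<open>Endpoints at \<open>b\<close> are redirected to \<open>a\<close>, which survives the
  removal of \<open>b\<close> because \<open>a \<noteq> b\<close>.\<close>

lemma finite_multigraph_contract_edge:
  assumes "finite_multigraph G" "e \<in> edges G" "ends G e = Upair a b" "a \<noteq> b"
  shows "finite_multigraph (contract_edge G e a b)"
  using assms finite_multigraph_ends[OF assms(1-3)]
  by (fastforce simp: finite_multigraph_def uprod.set_map)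

text \<open>Deletion and contraction both lower the number of edges by one. The weights are
  generalised in the induction because contraction changes them.\<close>

lemma is_V_polynomial_exists:
  assumes "finite_multigraph G"
  shows "\<exists>p. is_V_polynomial G \<omega> p"
  using assms
proof (induction "card (edges G)" arbitrary: G \<omega>)
  case 0
  then have "edges G = {}"
    by (simp add: finite_multigraph_def)
  then show ?case
    by (blast intro: is_V_polynomial.isolated)
next
  case (Suc n)
  then obtain e where e: "e \<in> edges G"
    by fastforce
  obtain a b where ab: "ends G e = Upair a b"
    by (cases "ends G e")
  have n: "n = card (edges G - {e})"
    using Suc.hyps(2) e by (simp add: finite_multigraph_def)
  obtain p where p: "is_V_polynomial (delete_edge G e) \<omega> p"
    using Suc.hyps(1)[of "delete_edge G e" \<omega>] n Suc.prems
    by (auto simp: finite_multigraph_delete_edge)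
  show ?case
  proof (cases "a = b")
    case True
    then show ?thesis
      using is_V_polynomial.loop[OF e _ p] ab by blast
  next
    case False
    then show ?thesis
      using Suc.hyps(1)[of "contract_edge G e a b" "\<omega>(a := \<omega> a + \<omega> b)"] n
        finite_multigraph_contract_edge[OF Suc.prems e ab False]
        is_V_polynomial.nonloop[OF e ab False p] by auto
  qed
qed


section \<open>The spanning subgraph expansion\<close>

text \<open>Connectedness in \<open>(V, A)\<close> is phrased without walks: every predicate
  that is constant on each edge of \<open>A\<close> takes the same value at both vertices.\<close>

definition edge_invariant :: "('v, 'e) multigraph \<Rightarrow> 'e set \<Rightarrow> ('v \<Rightarrow> bool) \<Rightarrow> bool" where
  "edge_invariant G A g \<longleftrightarrow> (\<forall>e\<in>A. \<forall>x\<in>set_uprod (ends G e). \<forall>y\<in>set_uprod (ends G e). g x = g y)"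

definition conn :: "('v, 'e) multigraph \<Rightarrow> 'e set \<Rightarrow> 'v \<Rightarrow> 'v \<Rightarrow> bool" where
  "conn G A u v \<longleftrightarrow> (\<forall>g. edge_invariant G A g \<longrightarrow> g u = g v)"

definition components :: "('v, 'e) multigraph \<Rightarrow> 'e set \<Rightarrow> 'v set set" where
  "components G A = (\<lambda>u. {v \<in> verts G. conn G A u v}) ` verts G"

text \<open>The class \<open>comm_monoid_add\<close> supplies the zero that \<open>sum\<close>
  requires; functions into the complex numbers with pointwise addition are an instance.\<close>

definition subgraph_term ::
  "('v, 'e) multigraph \<Rightarrow> ('v \<Rightarrow> 'w::comm_monoid_add) \<Rightarrow> 'e set \<Rightarrow> ('w, 'e) indet int_mpoly" where
  "subgraph_term G \<omega> A =
     (\<Prod>e\<in>A. indet_poly (Gam e)) * (\<Prod>C\<in>components G A. indet_poly (X (\<Sum>v\<in>C. \<omega> v)))"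

definition subgraph_sum ::
  "('v, 'e) multigraph \<Rightarrow> ('v \<Rightarrow> 'w::comm_monoid_add) \<Rightarrow> ('w, 'e) indet int_mpoly" where
  "subgraph_sum G \<omega> = (\<Sum>A\<in>Pow (edges G). subgraph_term G \<omega> A)"

section \<open>Components under deletion and contraction\<close>

lemma conn_delete_edge [simp]: "conn (delete_edge G e) A = conn G A"
  by (simp add: conn_def edge_invariant_def fun_eq_iff)

lemma components_delete_edge [simp]: "components (delete_edge G e) A = components G A"
  by (simp add: components_def)

lemma subgraph_term_delete_edge [simp]: "subgraph_term (delete_edge G e) \<omega> A = subgraph_term G \<omega> A"
  by (simp add: subgraph_term_def)

text \<open>A loop has a single endpoint and so constrains no predicate.\<close>

lemma components_insert_loop:
  assumes "ends G e = Upair a a"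
  shows "components G (insert e A) = components G A"
  using assms by (simp add: components_def conn_def edge_invariant_def)

lemma components_empty: "components G {} = (\<lambda>v. {v}) ` verts G"
proof -
  \<comment> \<open>Without edges every predicate is invariant, in particular the one singling out
    \<open>u\<close>.\<close>
  have "conn G {} u v \<longleftrightarrow> u = v" for u v
    unfolding conn_def edge_invariant_def by auto
  then show ?thesis
    by (auto simp: components_def)
qed

text \<open>The invariant predicates for \<open>insert e A\<close> are exactly the pullbacks along
  the merging map \<open>\<pi>\<close> of the invariant predicates of the contraction.\<close>

lemma conn_insert_contract_edge:
  fixes a b :: 'v
  assumes e: "ends G e = Upair a b"
  defines "\<pi> \<equiv> \<lambda>v. if v = b then a else v"
  shows "conn G (insert e A) u v \<longleftrightarrow> conn (contract_edge G e a b) A (\<pi> u) (\<pi> v)"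
proof -
  have contract: "edge_invariant (contract_edge G e a b) A g \<longleftrightarrow> edge_invariant G A (g \<circ> \<pi>)" for g
    unfolding edge_invariant_def contract_edge_simps uprod.set_map \<pi>_def[symmetric] by simp
  have "edge_invariant G (insert e A) g \<longleftrightarrow> edge_invariant G A g \<and> g a = g b" for g
    using e by (auto simp: edge_invariant_def)
  moreover have "g a = g b \<longleftrightarrow> g \<circ> \<pi> = g" for g :: "'v \<Rightarrow> bool"
    by (auto simp: \<pi>_def fun_eq_iff)
  ultimately have insert:
    "edge_invariant G (insert e A) g \<longleftrightarrow> edge_invariant G A (g \<circ> \<pi>) \<and> g \<circ> \<pi> = g" for g
    by metis
  \<comment> \<open>Idempotence of \<open>\<pi>\<close> lets \<open>g \<circ> \<pi>\<close> serve as
    a test predicate for connectedness in \<open>G\<close> whenever \<open>g\<close> is invariant on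
    the contraction.\<close>
  have "(g \<circ> \<pi>) \<circ> \<pi> = g \<circ> \<pi>" for g :: "'v \<Rightarrow> bool"
    by (simp add: \<pi>_def fun_eq_iff)
  then show ?thesis
    unfolding conn_def contract insert by (metis comp_apply)
qed

text \<open>Preimages under the merging map carry the components of the contraction bijectively to
  those of \<open>G\<close> with edge set \<open>insert e A\<close>. Total weights agree because the
  merged vertex carries the weights of both ends.\<close>

lemma subgraph_term_insert_nonloop:
  fixes G :: "('v, 'e) multigraph" and \<omega> :: "'v \<Rightarrow> 'w::comm_monoid_add"
  assumes fin: "finite_multigraph G" and e: "e \<in> edges G" "ends G e = Upair a b" "a \<noteq> b"
    and A: "A \<subseteq> edges G - {e}"
  shows "subgraph_term G \<omega> (insert e A) =
    indet_poly (Gam e) * subgraph_term (contract_edge G e a b) (\<omega>(a := \<omega> a + \<omega> b)) A"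
proof -
  let ?H = "contract_edge G e a b" and ?\<omega> = "\<omega>(a := \<omega> a + \<omega> b)"
  define \<pi> where "\<pi> v = (if v = b then a else v)" for v
  define pre where "pre D = {v \<in> verts G. \<pi> v \<in> D}" for D
  have ab: "a \<in> verts G" "b \<in> verts G"
    using finite_multigraph_ends[OF fin e(1,2)] .
  have finV: "finite (verts G)" and finA: "finite A"
    using fin A by (auto simp: finite_multigraph_def intro: finite_subset)
  have \<pi>_img: "\<pi> ` verts G = verts G - {b}"
    using ab e(3) by (force simp: \<pi>_def image_iff)
  have sub: "D \<subseteq> verts G - {b}" if "D \<in> components ?H A" for D
    using that by (auto simp: components_def)
  have conn_eq: "conn G (insert e A) u v \<longleftrightarrow> conn ?H A (\<pi> u) (\<pi> v)" for u v
    unfolding \<pi>_def by (rule conn_insert_contract_edge[OF e(2)])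
  have class_eq: "{v \<in> verts G. conn G (insert e A) u v} = pre {w \<in> verts ?H. conn ?H A (\<pi> u) w}" for u
    using \<pi>_img by (auto simp: pre_def conn_eq)
  have "components G (insert e A) = (\<lambda>u. pre {w \<in> verts ?H. conn ?H A (\<pi> u) w}) ` verts G"
    by (simp only: components_def class_eq)
  also have "\<dots> = pre ` (\<lambda>u. {w \<in> verts ?H. conn ?H A u w}) ` \<pi> ` verts G"
    by (simp only: image_image)
  also have "\<dots> = pre ` components ?H A"
    by (simp only: components_def \<pi>_img contract_edge_simps)
  finally have comps: "components G (insert e A) = pre ` components ?H A" .
  have inj: "inj_on pre (components ?H A)"
  \<comment> \<open>Taking images under \<open>\<pi>\<close> undoes \<open>pre\<close>: since
    \<open>b\<close> is not in \<open>D\<close>, \<open>\<pi>\<close> fixes every vertex of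
    \<open>D\<close>.\<close>
  proof (rule inj_on_inverseI)
    fix D assume "D \<in> components ?H A"
    then have D: "D \<subseteq> verts G - {b}"
      by (rule sub)
    then have "w \<in> pre D" "\<pi> w = w" if "w \<in> D" for w
      using that by (auto simp: pre_def \<pi>_def)
    then have "D \<subseteq> \<pi> ` pre D"
      by (metis image_eqI subsetI)
    then show "\<pi> ` pre D = D"
      by (auto simp: pre_def)
  qed
  have weight: "(\<Sum>v\<in>pre D. \<omega> v) = (\<Sum>v\<in>D. ?\<omega> v)" if D: "D \<subseteq> verts G - {b}" for D
  \<comment> \<open>Only a set containing the merged vertex \<open>a\<close> gains \<open>b\<close>;
    any other equals its own preimage.\<close>
  proof (cases "a \<in> D")
    case True
    then have "pre D = insert a (insert b (D - {a}))"
      using D ab by (auto simp: pre_def \<pi>_def)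
    moreover have "finite D" "b \<notin> D"
      using D finV by (auto intro: finite_subset)
    moreover have "(\<Sum>v\<in>D - {a}. ?\<omega> v) = (\<Sum>v\<in>D - {a}. \<omega> v)"
      by (rule sum.cong) auto
    ultimately show ?thesis
      using e(3) True by (simp add: sum.remove[of D a] add.assoc)
  next
    case False
    then have "pre D = D"
      using D by (auto simp: pre_def \<pi>_def)
    with False show ?thesis
      by (auto intro!: sum.cong)
  qed
  have "(\<Prod>C\<in>components G (insert e A). indet_poly (X (\<Sum>v\<in>C. \<omega> v)) :: ('w, 'e) indet int_mpoly) =
      (\<Prod>D\<in>components ?H A. indet_poly (X (\<Sum>v\<in>D. ?\<omega> v)))"
    unfolding comps prod.reindex[OF inj] o_def by (intro prod.cong refl) (simp only: weight sub)
  moreover have "e \<notin> A"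
    using A by blast
  ultimately show ?thesis
    using finA by (simp only: subgraph_term_def prod.insert mult.assoc simp_thms)
qed

section \<open>Recursion for the subgraph sum and uniqueness\<close>

lemma subgraph_sum_split:
  assumes "finite (edges G)" "e \<in> edges G"
  shows "subgraph_sum G \<omega> = subgraph_sum (delete_edge G e) \<omega> +
    (\<Sum>A\<in>Pow (edges G - {e}). subgraph_term G \<omega> (insert e A))"
proof -
  let ?P = "Pow (edges G - {e})"
  have "Pow (edges G) = ?P \<union> insert e ` ?P"
    using Pow_insert[of e "edges G - {e}"] assms(2) by (simp add: insert_absorb)
  moreover have "inj_on (insert e) ?P"
    by (auto simp: inj_on_def)
  moreover have "?P \<inter> insert e ` ?P = {}"
    by auto
  ultimately show ?thesis
    using assms by (simp add: subgraph_sum_def sum.union_disjoint sum.reindex)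
qed

text \<open>The subgraph sum mentions neither an order of the edges nor the name kept at a
  contraction, so all derivations have the same outcome. Each rule matches a splitting of the edge
  subsets by whether they contain \<open>e\<close>.\<close>

lemma is_V_polynomial_eq_subgraph_sum:
  fixes G :: "('v, 'e) multigraph" and \<omega> :: "'v \<Rightarrow> 'w::comm_monoid_add"
  assumes "is_V_polynomial G \<omega> p" "finite_multigraph G"
  shows "p = subgraph_sum G \<omega>"
  using assms
proof (induction rule: is_V_polynomial.induct)
  case (nonloop e G a b \<omega> p p')
  note fin = \<open>finite_multigraph G\<close>
  let ?H = "contract_edge G e a b" and ?\<omega> = "\<omega>(a := \<omega> a + \<omega> b)"
  have "(\<Sum>A\<in>Pow (edges G - {e}). subgraph_term G \<omega> (insert e A)) =
      (\<Sum>A\<in>Pow (edges G - {e}). indet_poly (Gam e) * subgraph_term ?H ?\<omega> A)"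
    using subgraph_term_insert_nonloop[OF fin nonloop.hyps(1-3)] by (intro sum.cong) auto
  also have "\<dots> = indet_poly (Gam e) * subgraph_sum ?H ?\<omega>"
    by (simp add: subgraph_sum_def sum_distrib_left)
  also have "subgraph_sum ?H ?\<omega> = p'"
    by (rule nonloop.IH(2)[OF finite_multigraph_contract_edge[OF fin nonloop.hyps(1-3)], symmetric])
  finally show ?case
    using subgraph_sum_split[of G e \<omega>] nonloop.hyps(1) nonloop.IH(1) fin
      finite_multigraph_delete_edge[OF fin]
    by (simp add: finite_multigraph_def)
next
  case (loop e G a \<omega> p)
  note fin = \<open>finite_multigraph G\<close>
  have "subgraph_term G \<omega> (insert e A) = indet_poly (Gam e) * subgraph_term G \<omega> A"
    if "A \<in> Pow (edges G - {e})" for A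
  proof -
    have "finite A" "e \<notin> A"
      using that fin by (auto simp: finite_multigraph_def intro: finite_subset)
    then show ?thesis
      using components_insert_loop[OF loop.hyps(2)] by (simp add: subgraph_term_def mult.assoc)
  qed
  then have "(\<Sum>A\<in>Pow (edges G - {e}). subgraph_term G \<omega> (insert e A)) =
      indet_poly (Gam e) * subgraph_sum (delete_edge G e) \<omega>"
    by (simp add: subgraph_sum_def sum_distrib_left)
  then show ?case
    using subgraph_sum_split[of G e \<omega>] loop fin finite_multigraph_delete_edge[OF fin]
    by (simp add: finite_multigraph_def distrib_right add.commute)
next
  case (isolated G \<omega>)
  have "(\<Prod>C\<in>(\<lambda>v. {v}) ` verts G. indet_poly (X (\<Sum>v\<in>C. \<omega> v)) :: ('w, 'e) indet int_mpoly) =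
      (\<Prod>v\<in>verts G. indet_poly (X (\<omega> v)))"
    by (subst prod.reindex) auto
  with isolated show ?case
    by (simp add: subgraph_sum_def subgraph_term_def components_empty)
qed

lemma is_V_polynomial_V_polynomial:
  fixes \<omega> :: "'v \<Rightarrow> 'w::comm_monoid_add"
  assumes "finite_multigraph G"
  shows "is_V_polynomial G \<omega> (V_polynomial G \<omega>)"
  unfolding V_polynomial_def
proof (rule theI')
  show "\<exists>!p. is_V_polynomial G \<omega> p"
    using is_V_polynomial_exists[OF assms] is_V_polynomial_eq_subgraph_sum[OF _ assms] by metis
qed


section \<open>Deletion-contraction for the partition function\<close>

lemma finite_states: "finite (verts G) \<Longrightarrow> finite (states q G)"
  by (simp add: states_def finite_PiE)

lemma states_delete_edge [simp]: "states q (delete_edge G e) = states q G"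
  by (simp add: states_def)

lemma boltzmann_delete_edge:
  assumes "finite (edges G)" "e \<in> edges G" "ends G e = Upair a b"
  shows "exp (- \<beta> * hamiltonian q G J M \<sigma>) =
    exp (- \<beta> * hamiltonian q (delete_edge G e) J M \<sigma>) *
    (1 + (exp (\<beta> * J e) - 1) * of_bool (\<sigma> a = \<sigma> b))"
proof -
  \<comment> \<open>The pair is unordered, but both ways of naming its ends give the same
    condition.\<close>
  have "(\<exists>i j. ends G e = Upair i j \<and> \<sigma> i = \<sigma> j) \<longleftrightarrow> \<sigma> a = \<sigma> b"
    using assms(3) by auto
  then have ham: "hamiltonian q G J M \<sigma> =
      hamiltonian q (delete_edge G e) J M \<sigma> - J e * of_bool (\<sigma> a = \<sigma> b)"
    unfolding hamiltonian_def sum.remove[OF assms(1,2)] by simp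
  have "- \<beta> * hamiltonian q G J M \<sigma> =
      - \<beta> * hamiltonian q (delete_edge G e) J M \<sigma> + \<beta> * J e * of_bool (\<sigma> a = \<sigma> b)"
    unfolding ham by (simp add: algebra_simps)
  then have "exp (- \<beta> * hamiltonian q G J M \<sigma>) =
      exp (- \<beta> * hamiltonian q (delete_edge G e) J M \<sigma>) * exp (\<beta> * J e * of_bool (\<sigma> a = \<sigma> b))"
    by (simp only: exp_add)
  \<comment> \<open>If the spins differ, both factors are 1; if they agree, both are
    \<open>exp (\<beta> * J e)\<close>.\<close>
  then show ?thesis
    by simp
qed

lemma partition_function_loop:
  assumes "finite (edges G)" "e \<in> edges G" "ends G e = Upair a a"
  shows "partition_function q \<beta> G J M =
    exp (\<beta> * J e) * partition_function q \<beta> (delete_edge G e) J M"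
  using boltzmann_delete_edge[OF assms]
  by (simp add: partition_function_def sum_distrib_left mult.commute)

text \<open>The update at \<open>b\<close> composes \<open>\<sigma>\<close> with the merging map, so
  edge terms correspond. The field term at the merged vertex splits into those at \<open>a\<close>
  and \<open>b\<close> because it is linear in the field.\<close>

lemma hamiltonian_contract_edge:
  assumes fin: "finite_multigraph G" and e: "e \<in> edges G" "ends G e = Upair a b" "a \<noteq> b"
  shows "hamiltonian q (contract_edge G e a b) J (M(a := M a + M b)) \<sigma> =
    hamiltonian q (delete_edge G e) J M (\<sigma>(b := \<sigma> a))"
proof -
  define \<pi> where "\<pi> v = (if v = b then a else v)" for v
  have ab: "a \<in> verts G" "b \<in> verts G"
    using finite_multigraph_ends[OF fin e(1,2)] .
  have finV: "finite (verts G)"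
    using fin by (simp add: finite_multigraph_def)
  have \<sigma>: "(\<sigma>(b := \<sigma> a)) v = \<sigma> (\<pi> v)" for v
    by (simp add: \<pi>_def)
  have edge: "(\<exists>i j. map_uprod \<pi> (ends G f) = Upair i j \<and> \<sigma> i = \<sigma> j) \<longleftrightarrow>
      (\<exists>i j. ends G f = Upair i j \<and> \<sigma> (\<pi> i) = \<sigma> (\<pi> j))" for f
    by (cases "ends G f") auto
  let ?t = "\<lambda>M \<sigma> v. \<Sum>\<alpha>=1..q. M v \<alpha> * (of_bool (\<alpha> = \<sigma> v) :: complex)"
  let ?U = "verts G - {b} - {a}"
  have "(\<Sum>v\<in>verts G - {b}. ?t (M(a := M a + M b)) \<sigma> v) =
      ?t (M(a := M a + M b)) \<sigma> a + (\<Sum>v\<in>?U. ?t (M(a := M a + M b)) \<sigma> v)"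
    using finV ab e(3) by (intro sum.remove) auto
  also have "?t (M(a := M a + M b)) \<sigma> a = ?t M (\<sigma>(b := \<sigma> a)) a + ?t M (\<sigma>(b := \<sigma> a)) b"
    using e(3) by (simp add: plus_fun_def distrib_right sum.distrib)
  also have "(\<Sum>v\<in>?U. ?t (M(a := M a + M b)) \<sigma> v) = (\<Sum>v\<in>?U. ?t M (\<sigma>(b := \<sigma> a)) v)"
    by (intro sum.cong) auto
  also have "?t M (\<sigma>(b := \<sigma> a)) a + ?t M (\<sigma>(b := \<sigma> a)) b + (\<Sum>v\<in>?U. ?t M (\<sigma>(b := \<sigma> a)) v) =
      (\<Sum>v\<in>verts G. ?t M (\<sigma>(b := \<sigma> a)) v)"
    using finV ab e(3) sum.remove[of "verts G" b "?t M (\<sigma>(b := \<sigma> a))"]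
      sum.remove[of "verts G - {b}" a "?t M (\<sigma>(b := \<sigma> a))"] by (simp add: add_ac)
  finally have field: "(\<Sum>v\<in>verts G - {b}. ?t (M(a := M a + M b)) \<sigma> v) =
      (\<Sum>v\<in>verts G. ?t M (\<sigma>(b := \<sigma> a)) v)" .
  show ?thesis
    unfolding hamiltonian_def contract_edge_simps delete_edge_simps field
    unfolding \<sigma> \<pi>_def[symmetric] edge ..
qed

lemma bij_betw_states_contract_edge:
  assumes "a \<in> verts G" "b \<in> verts G" "a \<noteq> b"
  shows "bij_betw (\<lambda>\<sigma>. \<sigma>(b := \<sigma> a)) (states q (contract_edge G e a b)) {\<sigma> \<in> states q G. \<sigma> a = \<sigma> b}"
\<comment> \<open>States are extensional on the vertex set, so the inverse resets the removed vertex
  \<open>b\<close> to \<open>undefined\<close>.\<close>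
proof (rule bij_betw_byWitness[where f' = "\<lambda>\<sigma>. \<sigma>(b := undefined)"])
  show "\<forall>\<sigma>\<in>states q (contract_edge G e a b). (\<sigma>(b := \<sigma> a))(b := undefined) = \<sigma>"
    by (auto simp: states_def PiE_def extensional_def fun_eq_iff)
  show "\<forall>\<sigma>\<in>{\<sigma> \<in> states q G. \<sigma> a = \<sigma> b}.
      (\<sigma>(b := undefined))(b := (\<sigma>(b := undefined)) a) = \<sigma>"
    using assms by (auto simp: fun_eq_iff)
  show "(\<lambda>\<sigma>. \<sigma>(b := \<sigma> a)) ` states q (contract_edge G e a b) \<subseteq> {\<sigma> \<in> states q G. \<sigma> a = \<sigma> b}"
    using assms by (auto simp: states_def PiE_def Pi_def extensional_def)
  show "(\<lambda>\<sigma>. \<sigma>(b := undefined)) ` {\<sigma> \<in> states q G. \<sigma> a = \<sigma> b}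
      \<subseteq> states q (contract_edge G e a b)"
    by (auto simp: states_def PiE_def Pi_def extensional_def)
qed

lemma partition_function_nonloop:
  assumes fin: "finite_multigraph G" and e: "e \<in> edges G" "ends G e = Upair a b" "a \<noteq> b"
  shows "partition_function q \<beta> G J M = partition_function q \<beta> (delete_edge G e) J M +
    (exp (\<beta> * J e) - 1) * partition_function q \<beta> (contract_edge G e a b) J (M(a := M a + M b))"
proof -
  let ?w = "\<lambda>\<sigma>. exp (- \<beta> * hamiltonian q (delete_edge G e) J M \<sigma>)"
  have finE: "finite (edges G)" and finV: "finite (verts G)"
    using fin by (simp_all add: finite_multigraph_def)
  have "partition_function q \<beta> G J M =
      (\<Sum>\<sigma>\<in>states q G. ?w \<sigma> + (exp (\<beta> * J e) - 1) * (?w \<sigma> * of_bool (\<sigma> a = \<sigma> b)))"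
    unfolding partition_function_def boltzmann_delete_edge[OF finE e(1,2)]
    by (intro sum.cong) (simp_all add: algebra_simps)
  also have "\<dots> = partition_function q \<beta> (delete_edge G e) J M +
      (exp (\<beta> * J e) - 1) * (\<Sum>\<sigma>\<in>states q G. ?w \<sigma> * of_bool (\<sigma> a = \<sigma> b))"
    by (simp add: partition_function_def sum.distrib sum_distrib_left)
  also have "(\<Sum>\<sigma>\<in>states q G. ?w \<sigma> * of_bool (\<sigma> a = \<sigma> b)) =
      (\<Sum>\<sigma>\<in>{\<sigma> \<in> states q G. \<sigma> a = \<sigma> b}. ?w \<sigma>)"
    using finite_states[OF finV] by (intro sum.mono_neutral_cong_right) auto
  also have "\<dots> = (\<Sum>\<sigma>\<in>states q (contract_edge G e a b). ?w (\<sigma>(b := \<sigma> a)))"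
    using bij_betw_states_contract_edge[OF finite_multigraph_ends[OF fin e(1,2)] e(3)]
    by (rule sum.reindex_bij_betw[symmetric])
  also have "\<dots> = partition_function q \<beta> (contract_edge G e a b) J (M(a := M a + M b))"
    unfolding partition_function_def hamiltonian_contract_edge[OF fin e] ..
  finally show ?thesis .
qed

text \<open>The energy is a sum of one-vertex terms, so each Boltzmann weight is a product and the
  sum over states factorises.\<close>

lemma partition_function_isolated:
  assumes "edges G = {}" "finite (verts G)"
  shows "partition_function q \<beta> G J M = (\<Prod>v\<in>verts G. \<Sum>\<alpha>=1..q. exp (\<beta> * M v \<alpha>))"
proof -
  have "exp (- \<beta> * hamiltonian q G J M \<sigma>) = (\<Prod>v\<in>verts G. exp (\<beta> * M v (\<sigma> v)))"
    if "\<sigma> \<in> states q G" for \<sigma>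
  proof -
    have "(\<Sum>\<alpha>=1..q. M v \<alpha> * of_bool (\<alpha> = \<sigma> v)) = M v (\<sigma> v)" if "v \<in> verts G" for v
    proof -
      \<comment> \<open>The spin must lie in the summation range for exactly one summand to
        survive.\<close>
      have "\<sigma> v \<in> {1..q}"
        using \<open>\<sigma> \<in> states q G\<close> that by (auto simp: states_def)
      then show ?thesis
        by (simp add: of_bool_def if_distrib cong: if_cong)
    qed
    then have "- \<beta> * hamiltonian q G J M \<sigma> = (\<Sum>v\<in>verts G. \<beta> * M v (\<sigma> v))"
      using assms(1) by (simp add: hamiltonian_def sum_distrib_left sum_negf)
    then show ?thesis
      using assms(2) by (simp add: exp_sum)
  qed
  then show ?thesis
    using assms(2) by (simp add: partition_function_def states_def prod_sum_PiE)
qed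

text \<open>Each coordinate from \<open>r + 1\<close> to \<open>q\<close> vanishes and contributes
  \<open>exp 0 = 1\<close>, which accounts for the constant \<open>q - r\<close>.\<close>

lemma sum_exp_eq_potts_subst:
  assumes "r \<le> q" "\<forall>\<alpha>\<in>{r<..q}. m \<alpha> = 0"
  shows "(\<Sum>\<alpha>=1..q. exp (\<beta> * m \<alpha>)) = potts_subst q r \<beta> J (X m)"
proof -
  have "{1..q} = {1..r} \<union> {r<..q}"
    using assms(1) by auto
  moreover have "{1..r} \<inter> {r<..q} = {}"
    by auto
  ultimately have "(\<Sum>\<alpha>=1..q. exp (\<beta> * m \<alpha>)) =
      (\<Sum>\<alpha>=1..r. exp (\<beta> * m \<alpha>)) + (\<Sum>\<alpha>\<in>{r<..q}. exp (\<beta> * m \<alpha>))"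
    by (simp only: sum.union_disjoint finite_atLeastAtMost finite_greaterThanAtMost)
  also have "(\<Sum>\<alpha>\<in>{r<..q}. exp (\<beta> * m \<alpha>)) = of_nat (q - r)"
    using assms(2) by simp
  \<comment> \<open>By \<open>r \<le> q\<close>, the subtraction of natural numbers is not truncated
    and commutes with \<open>of_nat\<close>.\<close>
  finally show ?thesis
    using assms(1) by (simp add: of_nat_diff)
qed

section \<open>Comparison along a derivation of the V-polynomial\<close>

lemma partition_function_eq_mpoly_subst:
  assumes "is_V_polynomial G M p" "finite_multigraph G" "r \<le> q"
    and "\<forall>v\<in>verts G. \<forall>\<alpha>\<in>{r<..q}. M v \<alpha> = 0"
  shows "partition_function q \<beta> G J M = mpoly_subst (potts_subst q r \<beta> J) p"
  using assms
proof (induction rule: is_V_polynomial.induct)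
  case (nonloop e G a b M p p')
  note fin = \<open>finite_multigraph G\<close>
  let ?H = "contract_edge G e a b" and ?M = "M(a := M a + M b)"
  \<comment> \<open>The edgeless case needs fields vanishing beyond \<open>r\<close>; contraction
    preserves this, as the sum of two such fields is again one.\<close>
  have "\<forall>v\<in>verts ?H. \<forall>\<alpha>\<in>{r<..q}. ?M v \<alpha> = 0"
    using nonloop.prems(3) finite_multigraph_ends[OF fin nonloop.hyps(1,2)] by simp
  then have "partition_function q \<beta> ?H J ?M = mpoly_subst (potts_subst q r \<beta> J) p'"
    by (rule nonloop.IH(2)[OF finite_multigraph_contract_edge[OF fin nonloop.hyps(1-3)] \<open>r \<le> q\<close>])
  moreover have "partition_function q \<beta> (delete_edge G e) J M = mpoly_subst (potts_subst q r \<beta> J) p"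
    using nonloop.IH(1) nonloop.prems by (simp add: finite_multigraph_delete_edge)
  ultimately show ?case
    unfolding partition_function_nonloop[OF fin nonloop.hyps(1-3)] mpoly_subst_add mpoly_subst_mult
    by simp
next
  case (loop e G a M p)
  \<comment> \<open>The factor \<open>indet_poly (Gam e) + 1\<close> is mapped to
    \<open>exp (\<beta> * J e)\<close>, the constant Boltzmann factor of a loop.\<close>
  then show ?case
    by (simp add: partition_function_loop finite_multigraph_delete_edge mpoly_subst_add
        mpoly_subst_mult finite_multigraph_def)
next
  case (isolated G M)
  have "(\<Prod>v\<in>verts G. \<Sum>\<alpha>=1..q. exp (\<beta> * M v \<alpha>)) =
      (\<Prod>v\<in>verts G. potts_subst q r \<beta> J (X (M v)))"
    using isolated.prems by (intro prod.cong refl sum_exp_eq_potts_subst) auto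
  with isolated show ?case
    by (simp add: partition_function_isolated finite_multigraph_def mpoly_subst_prod)
qed

theorem theorem5p6:
  fixes q r :: nat and \<beta> :: complex
    and G :: "('v, 'e) multigraph"
    and J :: "'e \<Rightarrow> complex"
    and M :: "'v \<Rightarrow> nat \<Rightarrow> complex"
  assumes "q \<ge> 1" and "r \<le> q"
    and "finite_multigraph G"
    and "\<forall>v\<in>verts G. M v \<in> complex_space q"
    and "\<forall>v\<in>verts G. \<forall>\<alpha>\<in>{r<..q}. M v \<alpha> = 0"
  shows "partition_function q \<beta> G J M = mpoly_subst (potts_subst q r \<beta> J) (V_polynomial G M)"
  using assms by (intro partition_function_eq_mpoly_subst is_V_polynomial_V_polynomial)

end
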